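(* Let $k\in[1:\min_{i\in[d]}n_i-1]$, let $S=\{t_1,\dots,t_s\}\subseteq\times_{i\in[d]}[k+2:n_i-k]$ with an associated hyperrectangular tessellation $\{R_m\}_{m=1}^s$ of $\times_{i\in[d]}[k+1:n_i]$, and let $\tilde S$ be the enlarged active set. For $m\in[s]$, $i\in[d]$ define $$\tilde v_{i,m}^2(j_i)=\begin{cases}\left(\frac{t_{i,m}-j_i}{n_i}\right)^{2k-1},&j_i\in[t_{i,m}^-:t_{i,m}],\\0,&j_i\in[t_{i,m}:t_{i,m}+k-1],\\\left(\frac{j_i-t_{i,m}-k+1}{n_i}\right)^{2k-1},&j_i\in[t_{i,m}+k-1:t_{i,m}^+],\end{cases}$$ and, for $(j_1,\dots,j_d)\in R_m$, $\tilde v_{j_1,\dots,j_d}:=\sqrt{\sum_{i=1}^d\tilde v_{i,m}^2(j_i)}$. Then for all $m\in[s]$ and all $(j_1,\dots,j_d)\in R_m$, $$\frac{\|\mathrm A_{\tilde S}\,\tilde\phi^k_{j_1,\dots,j_d}\|_2^2}{n}\le\tilde v_{j_1,\dots,j_d}^2 .$$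
   Context: Notation: $[i:j]=\{i,\dots,j\}$, $[j]=[1:j]$, $n=n_1\cdots n_d$, $\|\cdot\|_2$ is the Frobenius norm on $\mathbb{R}^{n_1\times\cdots\times n_d}$. One-dimensional dictionary (for length $N$; used with $N=n_i$ for coordinate $i$): $\phi^1_j=\{1_{\{j'\ge j\}}\}_{j'\in[N]}$; for $k\ge2$, $\phi^k_j=\phi^j_j$ if $j\in[k-1]$ and $\phi^k_j=\sum_{l\ge j}\phi^{k-1}_l/N$ if $j\in[k:N]$. With $\mathrm A_{W}$ the orthogonal projection onto the orthogonal complement of $\mathrm{span}(W)$, set $\tilde\phi^k_j=\mathrm A_{\{\phi^l_l,\,l\in[k]\}}\phi^k_j$ for $j\in[k+1:N]$. In $d$ dimensions, for $(j_1,\dots,j_d)\in\times_i[k+1:n_i]$, $\tilde\phi^k_{j_1,\dots,j_d}=\tilde\phi^k_{j_1}\times\cdots\times\tilde\phi^k_{j_d}$ is the outer product (entry at $(j_1',\dots,j_d')$ equal to $\prod_i\tilde\phi^k_{j_i}(j_i')$). Write $t_m=(t_{1,m},\dots,t_{d,m})$. The enlarged active set is $\tilde S=\bigcup_{m=1}^s\times_{i\in[d]}[t_{i,m}:t_{i,m}+k-1]$, and $\mathrm A_{\tilde S}$ is the orthogonal projection onto the orthogonal complement of $\mathrm{span}\{\tilde\phi^k_{j_1,\dots,j_d}:(j_1,\dots,j_d)\in\tilde S\}$. A hyperrectangular tessellation associated with $S$ is a family of hyperrectangles $R_m=\times_i[t_{i,m}^-:t_{i,m}^+]\subseteq\times_i[k+1:n_i]$,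 $m\in[s]$, with union $\times_i[k+1:n_i]$, such that distinct ones possibly share boundary points but not interior points, and such that all points of $\times_i[t_{i,m}:t_{i,m}+k-1]$ are interior points of $R_m$. If a point lies in several $R_m$, the inequality is claimed for each corresponding value of $\tilde v$. *)

theory Defs
  imports "HOL-Analysis.Analysis" "HOL-Library.Function_Algebras"
begin

section \<open>Real arrays on a finite index set\<close>

text \<open>
  Arrays with real entries indexed by a finite set \<open>X\<close> are functions that vanish outside \<open>X\<close>.
  The pointwise real vector space structure on functions makes the library's \<^const>\<open>span\<close>
  available; the Frobenius norm of \<open>f\<close> is \<open>L2_set f X\<close>.
\<close>

instantiation "fun" :: (type, real_vector) real_vector
begin

definition scaleR_fun :: "real \<Rightarrow> ('a \<Rightarrow> 'b) \<Rightarrow> 'a \<Rightarrow> 'b"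
  where "scaleR_fun c f = (\<lambda>x. c *\<^sub>R f x)"

instance
  by standard (simp_all add: scaleR_fun_def fun_eq_iff scaleR_add_right scaleR_add_left)

end

definition array_inner :: "'a set \<Rightarrow> ('a \<Rightarrow> real) \<Rightarrow> ('a \<Rightarrow> real) \<Rightarrow> real"
  where "array_inner X f g = (\<Sum>x\<in>X. f x * g x)"

definition array_orth_compl :: "'a set \<Rightarrow> ('a \<Rightarrow> real) set \<Rightarrow> ('a \<Rightarrow> real) set"
  where "array_orth_compl X U =
    {f. (\<forall>x. x \<notin> X \<longrightarrow> f x = 0) \<and> (\<forall>u\<in>U. array_inner X f u = 0)}"

definition array_orth_proj :: "'a set \<Rightarrow> ('a \<Rightarrow> real) set \<Rightarrow> ('a \<Rightarrow> real) \<Rightarrow> 'a \<Rightarrow> real"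
  where "array_orth_proj X V f =
    (THE g. g \<in> V \<and> (\<forall>v\<in>V. array_inner X (f - g) v = 0))"

text \<open>The antiprojection \<open>A\<^sub>W\<close>; \<open>antiproj_ex1\<close> below justifies the definite description.\<close>

definition antiproj :: "'a set \<Rightarrow> ('a \<Rightarrow> real) set \<Rightarrow> ('a \<Rightarrow> real) \<Rightarrow> 'a \<Rightarrow> real"
  where "antiproj X W = array_orth_proj X (array_orth_compl X (span W))"

lemma array_inner_simps:
  "array_inner X (f + g) h = array_inner X f h + array_inner X g h"
  "array_inner X (f - g) h = array_inner X f h - array_inner X g h"
  "array_inner X (c *\<^sub>R f) h = c * array_inner X f h"
  "array_inner X f (g + h) = array_inner X f g + array_inner X f h"
  "array_inner X f (g - h) = array_inner X f g - array_inner X f h"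
  "array_inner X f (c *\<^sub>R h) = c * array_inner X f h"
  by (simp_all add: array_inner_def scaleR_fun_def algebra_simps sum.distrib
      sum_subtractf sum_distrib_left)

lemma array_inner_commute: "array_inner X f g = array_inner X g f"
  by (simp add: array_inner_def mult.commute)

lemma array_inner_self_eq_0:
  assumes "finite X" "array_inner X f f = 0" "x \<in> X"
  shows "f x = 0"
  using assms by (simp add: array_inner_def sum_nonneg_eq_0_iff)

lemma array_inner_span_eq_0:
  assumes "\<And>w. w \<in> W \<Longrightarrow> array_inner X f w = 0" "u \<in> span W"
  shows "array_inner X f u = 0"
  using assms(2)
proof (induction rule: span_induct_alt)
  case base
  show ?case by (simp add: array_inner_def)
next
  case (step c x y)
  then show ?case by (simp only: array_inner_simps assms(1))
qed

lemma span_residual_ex: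
  assumes "finite X" "finite W"
  shows "\<exists>h\<in>span W. \<forall>w\<in>W. array_inner X (f - h) w = 0"
  using assms(2)
proof (induction W arbitrary: f rule: finite_induct)
  case empty
  show ?case by simp
next
  case (insert b W)
  obtain p where p: "p \<in> span W" "\<And>w. w \<in> W \<Longrightarrow> array_inner X (b - p) w = 0"
    using insert.IH by blast
  obtain h where h: "h \<in> span W" "\<And>w. w \<in> W \<Longrightarrow> array_inner X (f - h) w = 0"
    using insert.IH by blast
  define r where "r = b - p"
  define c where "c = array_inner X f r / array_inner X r r"
  have mono: "span W \<subseteq> span (insert b W)"
    by (intro span_mono) auto
  have r_in: "r \<in> span (insert b W)"
    unfolding r_def using p(1) mono by (intro span_diff) (auto intro: span_base)
  have b_eq: "b = r + p" by (simp add: r_def)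
  have rh: "array_inner X r u = 0" if "u \<in> span W" for u
    using array_inner_span_eq_0[OF _ that] p(2) by (simp add: r_def)
  have fh: "array_inner X (f - h) u = 0" if "u \<in> span W" for u
    using array_inner_span_eq_0[OF _ that] h(2) by blast
  have zero: "array_inner X g r = 0" if "array_inner X r r = 0" for g
    using array_inner_self_eq_0[OF assms(1) that] by (simp add: array_inner_def)
  have cr: "array_inner X f r - c * array_inner X r r = 0"
    by (cases "array_inner X r r = 0") (simp_all add: c_def zero)
  have "array_inner X (f - (h + c *\<^sub>R r)) w = 0" if "w \<in> insert b W" for w
  proof (cases "w \<in> W")
    case True
    then show ?thesis
      using h(2) rh[of w] by (simp add: array_inner_simps span_base)
  next
    case False
    with that have "w = r + p" using b_eq by simp
    moreover have "array_inner X h r = 0"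
      using rh[OF h(1)] by (simp add: array_inner_commute)
    ultimately show ?thesis
      using cr fh[OF p(1)] rh[OF p(1)] by (simp add: array_inner_simps)
  qed
  moreover have "h + c *\<^sub>R r \<in> span (insert b W)"
    using h(1) r_in mono by (intro span_add span_scale) auto
  ultimately show ?case by blast
qed

lemma antiproj_ex1:
  fixes X :: "'a set"
  assumes "finite X" "finite W"
  defines "V \<equiv> array_orth_compl X (span W)"
  shows "\<exists>!g. g \<in> V \<and> (\<forall>v\<in>V. array_inner X (f - g) v = 0)"
proof -
  obtain h where h: "h \<in> span W" "\<And>w. w \<in> W \<Longrightarrow> array_inner X (f - h) w = 0"
    using span_residual_ex[OF assms(1,2)] by blast
  define g where "g = (\<lambda>x. if x \<in> X then f x - h x else 0)"
  have "array_inner X g u = array_inner X (f - h) u" for u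
    by (simp add: array_inner_def g_def cong: sum.cong)
  with h(2) have "g \<in> V"
    by (auto simp: V_def array_orth_compl_def g_def intro: array_inner_span_eq_0)
  moreover have "array_inner X (f - g) v = 0" if "v \<in> V" for v
  proof -
    have "array_inner X (f - g) v = array_inner X h v"
      by (simp add: array_inner_def g_def cong: sum.cong)
    also have "\<dots> = 0"
      using that h(1) array_inner_commute[of X h v] by (simp add: V_def array_orth_compl_def)
    finally show ?thesis .
  qed
  moreover have "g1 = g2"
    if 1: "g1 \<in> V" "\<forall>v\<in>V. array_inner X (f - g1) v = 0"
      and 2: "g2 \<in> V" "\<forall>v\<in>V. array_inner X (f - g2) v = 0" for g1 g2
  proof
    fix x
    have "g1 - g2 \<in> V"
      using 1(1) 2(1) by (auto simp: V_def array_orth_compl_def array_inner_simps)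
    then have "array_inner X (f - g2) (g1 - g2) - array_inner X (f - g1) (g1 - g2) = 0"
      using 1(2) 2(2) by simp
    then have "array_inner X (g1 - g2) (g1 - g2) = 0"
      by (simp add: array_inner_simps algebra_simps)
    then have "x \<in> X \<Longrightarrow> g1 x = g2 x"
      using array_inner_self_eq_0[OF assms(1)] by fastforce
    then show "g1 x = g2 x"
      using 1(1) 2(1) by (cases "x \<in> X") (auto simp: V_def array_orth_compl_def)
  qed
  ultimately show ?thesis by blast
qed


section \<open>The dictionary\<close>

fun dict :: "nat \<Rightarrow> nat \<Rightarrow> nat \<Rightarrow> nat \<Rightarrow> real" where
  "dict N 0 j = (\<lambda>_. 0)"  \<comment> \<open>junk value: the order \<open>k\<close> is at least one\<close>
| "dict N (Suc 0) j = (\<lambda>j'. if j' \<in> {1..N} \<and> j \<le> j' then 1 else 0)"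
| "dict N (Suc (Suc k)) j =
    (if j < Suc (Suc k) then dict N j j
     else (\<lambda>j'. \<Sum>l = j..N. dict N (Suc k) l j' / real N))"

definition dict_tilde :: "nat \<Rightarrow> nat \<Rightarrow> nat \<Rightarrow> nat \<Rightarrow> real"
  where "dict_tilde N k j = antiproj {1..N} ((\<lambda>l. dict N l l) ` {1..k}) (dict N k j)"

text \<open>Points of the \<open>d\<close>-dimensional grid are extensional functions on \<open>{1..d}\<close>.\<close>

definition hyperrect :: "nat \<Rightarrow> (nat \<Rightarrow> nat) \<Rightarrow> (nat \<Rightarrow> nat) \<Rightarrow> (nat \<Rightarrow> nat) set"
  where "hyperrect d a b = (\<Pi>\<^sub>E i\<in>{1..d}. {a i..b i})"

text \<open>Interior in the discrete sense: strictly between the end points in every coordinate.\<close>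

definition hyperrect_interior :: "nat \<Rightarrow> (nat \<Rightarrow> nat) \<Rightarrow> (nat \<Rightarrow> nat) \<Rightarrow> (nat \<Rightarrow> nat) set"
  where "hyperrect_interior d a b = (\<Pi>\<^sub>E i\<in>{1..d}. {a i<..<b i})"

definition grid :: "nat \<Rightarrow> (nat \<Rightarrow> nat) \<Rightarrow> (nat \<Rightarrow> nat) set"
  where "grid d n = hyperrect d (\<lambda>_. 1) n"

definition tensor_dict ::
    "nat \<Rightarrow> (nat \<Rightarrow> nat) \<Rightarrow> nat \<Rightarrow> (nat \<Rightarrow> nat) \<Rightarrow> (nat \<Rightarrow> nat) \<Rightarrow> real"
  where "tensor_dict d n k j =
    (\<lambda>j'. if j' \<in> grid d n then \<Prod>i = 1..d. dict_tilde (n i) k (j i) (j' i) else 0)"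


section \<open>Active sets and tessellations\<close>

text \<open>The active point \<open>t\<^sub>m\<close> is \<open>t m\<close>, with coordinates \<open>t m i\<close> for \<open>i \<in> {1..d}\<close>.\<close>

definition active_block :: "nat \<Rightarrow> nat \<Rightarrow> (nat \<Rightarrow> nat) \<Rightarrow> (nat \<Rightarrow> nat) set"
  where "active_block d k p = hyperrect d p (\<lambda>i. p i + k - 1)"

definition enlarged_active_set ::
    "nat \<Rightarrow> nat \<Rightarrow> nat \<Rightarrow> (nat \<Rightarrow> nat \<Rightarrow> nat) \<Rightarrow> (nat \<Rightarrow> nat) set"
  where "enlarged_active_set d k s t = (\<Union>m\<in>{1..s}. active_block d k (t m))"

text \<open>
  Distinct cells may share boundary points but not interior points: no grid point is interior to
  two of them.
\<close>

definition hyperrect_tessellation ::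
    "nat \<Rightarrow> (nat \<Rightarrow> nat) \<Rightarrow> nat \<Rightarrow> nat \<Rightarrow> (nat \<Rightarrow> nat \<Rightarrow> nat) \<Rightarrow>
     (nat \<Rightarrow> nat \<Rightarrow> nat) \<Rightarrow> (nat \<Rightarrow> nat \<Rightarrow> nat) \<Rightarrow> bool"
  where "hyperrect_tessellation d n k s t tminus tplus \<longleftrightarrow>
    (\<forall>m\<in>{1..s}. hyperrect d (tminus m) (tplus m) \<subseteq> hyperrect d (\<lambda>_. k + 1) n) \<and>
    (\<Union>m\<in>{1..s}. hyperrect d (tminus m) (tplus m)) = hyperrect d (\<lambda>_. k + 1) n \<and>
    (\<forall>m\<in>{1..s}. \<forall>m'\<in>{1..s}. m \<noteq> m' \<longrightarrow>
      hyperrect_interior d (tminus m) (tplus m) \<inter> hyperrect_interior d (tminus m') (tplus m') = {}) \<and>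
    (\<forall>m\<in>{1..s}. active_block d k (t m) \<subseteq> hyperrect_interior d (tminus m) (tplus m))"

text \<open>
  One coordinate of the squared bound, with \<open>N = n\<^sub>i\<close>, \<open>p = t\<^sub>i\<^sub>,\<^sub>m\<close> and \<open>[a:b]\<close> the
  \<open>i\<close>-th side of \<open>R\<^sub>m\<close>.  The overlapping cases agree (both give 0) for \<open>k \<ge> 1\<close>; the last
  branch is a junk value outside \<open>[a:b]\<close>.
\<close>

definition vtilde_sq :: "nat \<Rightarrow> nat \<Rightarrow> nat \<Rightarrow> nat \<Rightarrow> nat \<Rightarrow> nat \<Rightarrow> real"
  where "vtilde_sq N k p a b j =
    (if j \<in> {a..p} then ((real p - real j) / real N) ^ (2 * k - 1)
     else if j \<in> {p..p + k - 1} then 0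
     else if j \<in> {p + k - 1..b} then ((real j - real p - real k + 1) / real N) ^ (2 * k - 1)
     else 0)"

definition vtilde ::
    "nat \<Rightarrow> (nat \<Rightarrow> nat) \<Rightarrow> nat \<Rightarrow> (nat \<Rightarrow> nat) \<Rightarrow> (nat \<Rightarrow> nat) \<Rightarrow> (nat \<Rightarrow> nat) \<Rightarrow>
     (nat \<Rightarrow> nat) \<Rightarrow> real"
  where "vtilde d n k p a b j = sqrt (\<Sum>i = 1..d. vtilde_sq (n i) k (p i) (a i) (b i) (j i))"

end

theory Submission
  imports Defs
begin

text \<open>
  Projecting onto fewer vectors only enlarges the residual, so it suffices to use the block at
  \<open>t\<^sub>m\<close>.  In one dimension, \<open>\<phi>\<^sup>k\<^sub>j\<close> is a truncated discrete power of degree \<open>k - 1\<close>, and the \<open>k\<close>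
  truncated powers of the block \<open>[p : p + k - 1]\<close> reproduce every polynomial of degree below \<open>k\<close>
  on \<open>[p : N]\<close> while vanishing before \<open>p\<close>.  Subtracting from \<open>\<phi>\<^sup>k\<^sub>j\<close> the combination that
  reproduces its own polynomial leaves an array supported between \<open>j\<close> and the block, and counting
  points times squared height gives the exponent \<open>2 k - 1\<close>.  For tensor products,
  the product of the one-dimensional projections lies in the span, and its squared distance
  is a difference of products \<open>\<Prod>a\<^sub>i - \<Prod>b\<^sub>i\<close> of squared norms; after normalisation
  these lie in \<open>[0, 1]\<close>, so the difference is at most \<open>\<Sum>(a\<^sub>i - b\<^sub>i)\<close>.
\<close>

section \<open>Antiprojections: characterisation, linearity and norm bound\<close>

lemma scaleR_fun_apply: "(c *\<^sub>R f) x = c *\<^sub>R f x"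
  by (simp add: scaleR_fun_def)

lemma array_inner_self_nonneg: "0 \<le> array_inner X f f"
  by (simp add: array_inner_def sum_nonneg)

lemma L2_set_power2_eq_array_inner: "(L2_set f X)\<^sup>2 = array_inner X f f"
  by (simp add: L2_set_def array_inner_def sum_nonneg power2_eq_square)

lemma antiproj_mem:
  assumes "finite X" "finite W"
  shows "antiproj X W f \<in> array_orth_compl X (span W)"
  using theI'[OF antiproj_ex1[OF assms, of f]]
  unfolding antiproj_def array_orth_proj_def by blast

lemma antiproj_residual:
  assumes "finite X" "finite W" "v \<in> array_orth_compl X (span W)"
  shows "array_inner X (f - antiproj X W f) v = 0"
  using theI'[OF antiproj_ex1[OF assms(1,2), of f]] assms(3)
  unfolding antiproj_def array_orth_proj_def by blast

lemma antiproj_eqI: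
  assumes "finite X" "finite W" "g \<in> array_orth_compl X (span W)"
    and "\<And>v. v \<in> array_orth_compl X (span W) \<Longrightarrow> array_inner X (f - g) v = 0"
  shows "antiproj X W f = g"
  unfolding antiproj_def array_orth_proj_def
  by (rule the1_equality[OF antiproj_ex1[OF assms(1,2)]]) (use assms(3,4) in blast)

text \<open>Sums and multiples inherit the conditions that determine the residual uniquely.
  Linearity is what later carries combinations of \<open>dict\<close> atoms to combinations of
  \<open>dict_tilde\<close> atoms.\<close>

lemma linear_antiproj:
  assumes "finite X" "finite W"
  shows "linear (antiproj X W)"
proof (rule linearI)
  fix f g
  show "antiproj X W (f + g) = antiproj X W f + antiproj X W g"
  proof (rule antiproj_eqI[OF assms])
    show "antiproj X W f + antiproj X W g \<in> array_orth_compl X (span W)"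
      using antiproj_mem[OF assms, of f] antiproj_mem[OF assms, of g]
      by (auto simp: array_orth_compl_def array_inner_simps)
    show "array_inner X (f + g - (antiproj X W f + antiproj X W g)) v = 0"
      if "v \<in> array_orth_compl X (span W)" for v
      using antiproj_residual[OF assms that, of f] antiproj_residual[OF assms that, of g]
      by (simp add: array_inner_simps)
  qed
next
  fix c f
  show "antiproj X W (c *\<^sub>R f) = c *\<^sub>R antiproj X W f"
  proof (rule antiproj_eqI[OF assms])
    show "c *\<^sub>R antiproj X W f \<in> array_orth_compl X (span W)"
      using antiproj_mem[OF assms, of f]
      by (auto simp: array_orth_compl_def array_inner_simps scaleR_fun_apply)
    show "array_inner X (c *\<^sub>R f - c *\<^sub>R antiproj X W f) v = 0"
      if "v \<in> array_orth_compl X (span W)" for v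
      using antiproj_residual[OF assms that, of f]
      by (simp add: array_inner_simps)
  qed
qed

text \<open>The residual \<open>g\<close> is orthogonal to both \<open>f - g\<close> and
  \<open>u\<close>, so the squared norm of \<open>f - u - g\<close> is exactly the right side minus
  the left side. Taking \<open>u = 0\<close> shows that antiprojection is a contraction.\<close>

lemma antiproj_norm_le:
  assumes "finite X" "finite W" "u \<in> span W"
  shows "array_inner X (antiproj X W f) (antiproj X W f) \<le> array_inner X (f - u) (f - u)"
proof -
  define g where "g = antiproj X W f"
  have g: "g \<in> array_orth_compl X (span W)"
    unfolding g_def by (rule antiproj_mem[OF assms(1,2)])
  have "array_inner X (f - g) g = 0"
    using antiproj_residual[OF assms(1,2) g] by (simp add: g_def)
  moreover have "array_inner X g u = 0"
    using g assms(3) by (simp add: array_orth_compl_def)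
  moreover have "0 \<le> array_inner X (f - u - g) (f - u - g)"
    by (rule array_inner_self_nonneg)
  ultimately show ?thesis
    unfolding g_def[symmetric]
    by (simp add: array_inner_simps array_inner_commute[of X g f] array_inner_commute[of X u g])
qed


section \<open>Truncated discrete powers\<close>

text \<open>The hockey-stick identity: lowering \<open>j\<close> adds one term, absorbed by Pascal's
  rule. It evaluates the repeated sums that build the dictionary.\<close>

lemma sum_diff_choose:
  fixes j x k :: nat
  assumes "j \<le> x"
  shows "(\<Sum>l = j..x. (x - l + k) choose k) = (x - j + Suc k) choose Suc k"
  using assms
proof (induction j rule: inc_induct)
  case base
  show ?case by simp
next
  case (step j)
  have "(\<Sum>l = j..x. (x - l + k) choose k)
      = ((x - j + k) choose k) + ((x - Suc j + Suc k) choose Suc k)"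
    using step by (simp only: sum.atLeast_Suc_atMost less_imp_le)
  also have "x - Suc j + Suc k = x - j + k" using step.hyps by simp
  also have "((x - j + k) choose k) + ((x - j + k) choose Suc k) = (x - j + Suc k) choose Suc k"
    by (simp only: add_Suc_right binomial_Suc_Suc)
  finally show ?case .
qed

text \<open>The coefficient is the product of \<open>(i + r) / r\<close> over
  \<open>r = 1, ..., k\<close>, and each factor is at most \<open>i + 1\<close>.\<close>

lemma add_choose_le_power: "(i + k) choose k \<le> (i + 1) ^ k"
proof (induction k)
  case 0
  show ?case by simp
next
  case (Suc k)
  have "Suc k * ((i + Suc k) choose Suc k) = (i + Suc k) * ((i + k) choose k)"
    using Suc_times_binomial[of k "i + k"] by simp
  also have "\<dots> \<le> (Suc k * (i + 1)) * (i + 1) ^ k"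
    by (rule mult_le_mono[OF _ Suc]) (simp add: algebra_simps)
  finally have "Suc k * ((i + Suc k) choose Suc k) \<le> Suc k * (i + 1) ^ Suc k"
    by (simp only: power_Suc mult.assoc)
  then show ?case by (simp only: mult_le_cancel1)
qed

text \<open>Order \<open>Suc k\<close> corresponds to degree \<open>k\<close>: each further
  summation raises the degree by one. The condition on \<open>j\<close> avoids the branch where
  lower-order atoms are kept, for \<open>j\<close> and for every \<open>l\<close> in the
  sum.\<close>

lemma dict_eq:
  assumes "Suc k \<le> j"
  shows "dict N (Suc k) j x =
    (if x \<in> {1..N} \<and> j \<le> x then real ((x - j + k) choose k) / real N ^ k else 0)"
  using assms
proof (induction k arbitrary: j)
  case 0
  show ?case by simp
next
  case (Suc k)
  have IH: "dict N (Suc k) l x =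
      (if x \<in> {1..N} \<and> l \<le> x then real ((x - l + k) choose k) / real N ^ k else 0)"
    if "l \<in> {j..N}" for l
    using that Suc.prems by (intro Suc.IH) simp
  have "dict N (Suc (Suc k)) j x = (\<Sum>l = j..N. dict N (Suc k) l x / real N)"
    using Suc.prems by simp
  also have "\<dots> = (\<Sum>l = j..N. if x \<in> {1..N} \<and> l \<le> x
      then real ((x - l + k) choose k) / real N ^ k / real N else 0)"
    by (rule sum.cong) (simp_all add: IH)
  also have "\<dots> = (if x \<in> {1..N} \<and> j \<le> x
      then real ((x - j + Suc k) choose Suc k) / real N ^ Suc k else 0)"
  proof (cases "x \<in> {1..N} \<and> j \<le> x")
    case True
    have "(\<Sum>l = j..N. if x \<in> {1..N} \<and> l \<le> x
        then real ((x - l + k) choose k) / real N ^ k / real N else 0)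
      = (\<Sum>l = j..x. real ((x - l + k) choose k) / real N ^ k / real N)"
      using True by (intro sum.mono_neutral_cong_right) auto
    also have "\<dots> = real (\<Sum>l = j..x. (x - l + k) choose k) / real N ^ Suc k"
      by (simp add: sum_divide_distrib mult.commute)
    finally show ?thesis
      by (simp only: if_P[OF True] sum_diff_choose[OF conjunct2[OF True]])
  next
    case False
    then show ?thesis by (auto intro!: sum.neutral)
  qed
  finally show ?case .
qed

lemma dict_Suc_bounds:
  assumes "Suc k \<le> j"
  shows "0 \<le> dict N (Suc k) j x" "dict N (Suc k) j x \<le> (real (x - j + 1) / real N) ^ k"
proof -
  have "real ((x - j + k) choose k) \<le> real ((x - j + 1) ^ k)"
    by (simp only: of_nat_le_iff add_choose_le_power)
  then show "dict N (Suc k) j x \<le> (real (x - j + 1) / real N) ^ k"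
    by (simp only: dict_eq[OF assms]) (auto simp: power_divide divide_right_mono)
  show "0 \<le> dict N (Suc k) j x"
    by (simp only: dict_eq[OF assms]) simp
qed

text \<open>The polynomial behind the atom at \<open>a\<close>, without truncation or scaling. The
  generalised coefficient gives it values to the left of \<open>a\<close>; the integer shift allows
  induction in both directions.\<close>

definition binom_poly :: "nat \<Rightarrow> int \<Rightarrow> real \<Rightarrow> real"
  where "binom_poly k a = (\<lambda>x. (x - of_int a + of_nat k) gchoose k)"

lemma binom_poly_Suc: "binom_poly (Suc k) a = binom_poly (Suc k) (a + 1) + binom_poly k a"
proof
  fix x :: real
  show "binom_poly (Suc k) a x = (binom_poly (Suc k) (a + 1) + binom_poly k a) x"
    using gbinomial_Suc_Suc[of "x - of_int a + of_nat k" k]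
    by (simp add: binom_poly_def algebra_simps)
qed

text \<open>
  Differences of consecutive shifts have one degree less, so the induction hypothesis puts all
  of them in the span; one shift then reaches every other one.
\<close>

lemma binom_poly_in_span: "binom_poly k a \<in> span (binom_poly k ` {p..p + int k})"
proof (induction k arbitrary: a)
  case 0
  have "binom_poly 0 a = binom_poly 0 p"
    by (simp add: binom_poly_def)
  then show ?case by (simp add: span_base)
next
  case (Suc k)
  let ?V = "span (binom_poly (Suc k) ` {p..p + int (Suc k)})"
  have shift: "binom_poly (Suc k) l \<in> ?V" if "l \<in> {p..p + int (Suc k)}" for l
    using that by (intro span_base) simp
  have "binom_poly k l \<in> ?V" if "l \<in> {p..p + int k}" for l
  proof -
    have "binom_poly k l = binom_poly (Suc k) l - binom_poly (Suc k) (l + 1)"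
      by (simp add: binom_poly_Suc[of k l])
    also have "\<dots> \<in> ?V"
      using that by (intro span_diff shift) auto
    finally show ?thesis .
  qed
  then have "span (binom_poly k ` {p..p + int k}) \<subseteq> ?V"
    by (intro span_minimal subspace_span) auto
  with Suc have lower: "binom_poly k b \<in> ?V" for b by blast
  show ?case
  proof (induction a rule: int_induct[where k = p])
    case base
    show ?case by (rule shift) simp
  next
    case (step1 i)
    have "binom_poly (Suc k) (i + 1) = binom_poly (Suc k) i - binom_poly k i"
      by (simp add: binom_poly_Suc[of k i])
    then show ?case using span_diff[OF step1.IH lower[of i]] by metis
  next
    case (step2 i)
    have "binom_poly (Suc k) (i - 1) = binom_poly (Suc k) i + binom_poly k (i - 1)"
      using binom_poly_Suc[of k "i - 1"] by simp
    then show ?case using span_add[OF step2.IH lower[of "i - 1"]] by metis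
  qed
qed

lemma binom_poly_ge:
  assumes "j \<le> x"
  shows "binom_poly k (int j) (real x) = real ((x - j + k) choose k)"
proof -
  have "real x - real j + real k = real (x - j + k)"
    using assms by (simp add: of_nat_diff)
  then show ?thesis by (simp only: binom_poly_def of_int_of_nat_eq binomial_gbinomial)
qed

text \<open>The upper index is a natural number below \<open>k\<close>, so the \<open>k\<close>
  integers just before \<open>j\<close> are zeros. Truncation there changes nothing, so an atom
  agrees with its polynomial from \<open>j - k\<close> on.\<close>

lemma binom_poly_near:
  assumes "x < j" "j \<le> x + k"
  shows "binom_poly k (int j) (real x) = 0"
proof -
  have "real x - real j + real k = real (x + k - j)"
    using assms by (simp add: of_nat_diff)
  then have "binom_poly k (int j) (real x) = real ((x + k - j) choose k)"
    by (simp add: binom_poly_def binomial_gbinomial)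
  also have "\<dots> = 0" using assms by simp
  finally show ?thesis .
qed

text \<open>Upper negation turns the coefficient into an ordinary one with sign
  \<open>(-1) ^ k\<close>; this measures the polynomial where truncation does change it.\<close>

lemma abs_binom_poly_less:
  assumes "x < j"
  shows "\<bar>binom_poly k (int j) (real x)\<bar> = real ((j - x - 1) choose k)"
proof -
  have "real k - (real x - real j + real k) - 1 = real (j - x - 1)"
    using assms by (simp add: of_nat_diff)
  then have "binom_poly k (int j) (real x) = (-1) ^ k * real ((j - x - 1) choose k)"
    by (simp only: binom_poly_def of_int_of_nat_eq binomial_gbinomial
        gbinomial_negated_upper[of "real x - real j + real k" k])
  then show ?thesis by (simp add: abs_mult)
qed

lemma dict_eq_binom_poly:
  assumes "Suc k \<le> j" "x \<in> {1..N}" "j \<le> x + k"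
  shows "dict N (Suc k) j x = binom_poly k (int j) (real x) / real N ^ k"
  using assms by (cases "j \<le> x") (simp_all add: dict_eq binom_poly_ge binom_poly_near)

section \<open>Squared distance from an atom to the span of a block\<close>

lemma array_inner_self_le_card:
  assumes "finite X" "D \<subseteq> X" "card D \<le> m"
    and "\<And>x. x \<in> X - D \<Longrightarrow> f x = 0" "\<And>x. x \<in> D \<Longrightarrow> \<bar>f x\<bar> \<le> c"
  shows "array_inner X f f \<le> real m * c\<^sup>2"
proof -
  have "array_inner X f f = (\<Sum>x\<in>D. f x * f x)"
    unfolding array_inner_def using assms by (intro sum.mono_neutral_right) auto
  also have "\<dots> \<le> (\<Sum>x\<in>D. c\<^sup>2)"
    using assms(5) by (intro sum_mono) (metis abs_le_square_iff abs_of_nonneg abs_ge_zero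
      order_trans power2_eq_square)
  also have "\<dots> \<le> real m * c\<^sup>2"
    using assms(3) by (simp add: mult_right_mono)
  finally show ?thesis .
qed

lemma dict_approx:
  assumes p: "Suc k < p" "p + k \<le> N" and j: "Suc k < j" "j \<le> N" "j \<in> {a..b}"
  shows "\<exists>g\<in>span (dict N (Suc k) ` {p..p + k}).
    array_inner {1..N} (dict N (Suc k) j - g) (dict N (Suc k) j - g)
      \<le> real N * vtilde_sq N (Suc k) p a b j"
proof -
  have N: "N > 0" using p by simp
  \<comment> \<open>Cut a polynomial off before \<open>p\<close> and rescale. For \<open>l\<close>
    in the block, the zeros just before \<open>l\<close> cover \<open>[p : l - 1]\<close> because
    \<open>l \<le> p + k\<close>, so the polynomial at \<open>l\<close> becomes exactly the atom at
    \<open>l\<close>.\<close>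
  define R :: "(real \<Rightarrow> real) \<Rightarrow> nat \<Rightarrow> real"
    where "R = (\<lambda>f x. if x \<in> {p..N} then f (real x) / real N ^ k else 0)"
  have "linear R"
    by (rule linearI) (auto simp: R_def fun_eq_iff scaleR_fun_def add_divide_distrib)
  have R_eq: "R (binom_poly k (int l)) = dict N (Suc k) l" if "l \<in> {p..p + k}" for l
  proof
    fix x
    show "R (binom_poly k (int l)) x = dict N (Suc k) l x"
      using that p dict_eq_binom_poly[of k l x N] dict_eq[of k l N x]
      by (cases "x \<in> {p..N}") (auto simp: R_def)
  qed
  have "{int p..int p + int k} = int ` {p..p + k}"
    using image_int_atLeastAtMost[of p "p + k"] by simp
  then have "R ` binom_poly k ` {int p..int p + int k} = dict N (Suc k) ` {p..p + k}"
    using R_eq by (simp only: image_image) (rule image_cong[OF refl])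
  then have R_span: "R (binom_poly k (int j)) \<in> span (dict N (Suc k) ` {p..p + k})"
    using linear_span_image[OF \<open>linear R\<close>] binom_poly_in_span[of k "int j" "int p"]
    by (metis imageI)
  define f where "f = dict N (Suc k) j - R (binom_poly k (int j))"
  have ge: "f x = 0" if "x \<in> {p..N}" "j \<le> x + k" for x
    using that dict_eq_binom_poly[of k j x N] j p by (simp add: f_def R_def)
  have lt: "f x = dict N (Suc k) j x" if "x < p" for x
    using that by (simp add: f_def R_def)
  have far: "\<bar>f x\<bar> = real ((j - x - 1) choose k) / real N ^ k"
    if "x \<in> {p..N}" "x < j" for x
    using that p j dict_eq[of k j N x] abs_binom_poly_less[of x j k]
    by (simp add: f_def R_def)
  have zero: "dict N (Suc k) j x = 0" if "x < j" for x
    using that j by (simp add: dict_eq)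
  \<comment> \<open>At most \<open>m\<close> support points times the squared height bound; the
    factor \<open>m\<close> supplies the odd exponent and leaves one factor
    \<open>N\<close>.\<close>
  have pow: "real m * ((real m / real N) ^ k)\<^sup>2 = real N * (real m / real N) ^ (2 * Suc k - 1)" for m
    using N by (simp add: power_mult[symmetric] mult.commute)
  \<comment> \<open>With \<open>j\<close> before the block, \<open>f\<close> is the atom on
    \<open>[j : p - 1]\<close>; inside the block, \<open>f\<close> vanishes; beyond it,
    \<open>f\<close> is minus the polynomial on \<open>[p : j - k - 1]\<close>.\<close>
  consider "j \<le> p" | "p < j" "j \<le> p + k" | "p + k < j" by linarith
  then have "array_inner {1..N} f f \<le> real N * vtilde_sq N (Suc k) p a b j"
  proof cases
    case 1
    have "array_inner {1..N} f f \<le> real (p - j) * ((real (p - j) / real N) ^ k)\<^sup>2"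
    proof (rule array_inner_self_le_card[where D = "{j..<p}"])
      show "f x = 0" if "x \<in> {1..N} - {j..<p}" for x
        using that 1 ge[of x] lt[of x] zero[of x] by (cases "x < p") auto
      show "\<bar>f x\<bar> \<le> (real (p - j) / real N) ^ k" if "x \<in> {j..<p}" for x
      proof -
        have "\<bar>f x\<bar> \<le> (real (x - j + 1) / real N) ^ k"
          using that lt[of x] dict_Suc_bounds[of k j N x] j by simp
        also have "\<dots> \<le> (real (p - j) / real N) ^ k"
          using that by (intro power_mono divide_right_mono) auto
        finally show ?thesis .
      qed
    qed (use p j in auto)
    also have "\<dots> = real N * vtilde_sq N (Suc k) p a b j"
      using 1 j by (simp only: pow) (simp add: vtilde_sq_def of_nat_diff)
    finally show ?thesis .
  next
    case 2
    have "f x = 0" if "x \<in> {1..N}" for x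
      using that 2 ge[of x] lt[of x] zero[of x] by (cases "x < p") auto
    then have "array_inner {1..N} f f = 0"
      by (simp add: array_inner_def)
    with 2 show ?thesis by (simp add: vtilde_sq_def)
  next
    case 3
    have "array_inner {1..N} f f \<le> real (j - p - k) * ((real (j - p - k) / real N) ^ k)\<^sup>2"
    proof (rule array_inner_self_le_card[where D = "{p..<j - k}"])
      show "f x = 0" if "x \<in> {1..N} - {p..<j - k}" for x
        using that 3 ge[of x] lt[of x] zero[of x] by (cases "x < p") auto
      show "\<bar>f x\<bar> \<le> (real (j - p - k) / real N) ^ k" if "x \<in> {p..<j - k}" for x
      proof -
        \<comment> \<open>Splitting off \<open>k\<close> gives the height bound
          \<open>(j - x - k) ^ k\<close>, largest at \<open>x = p\<close>. The resulting
          \<open>j - p - k\<close> is the numerator in \<open>vtilde_sq\<close> at order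
          \<open>Suc k\<close>.\<close>
        have "j - x - 1 = j - x - k - 1 + k"
          using that by auto
        then have "(j - x - 1) choose k \<le> (j - x - k - 1 + 1) ^ k"
          by (simp only: add_choose_le_power)
        also have "\<dots> \<le> (j - p - k) ^ k"
          using that by (intro power_mono) auto
        finally have "real ((j - x - 1) choose k) \<le> real (j - p - k) ^ k"
          by (simp only: of_nat_power[symmetric] of_nat_le_iff)
        then show ?thesis
          using that j by (subst far) (auto simp: power_divide divide_right_mono)
      qed
    qed (use p j in auto)
    also have "\<dots> = real N * vtilde_sq N (Suc k) p a b j"
      using 3 j by (simp only: pow) (simp add: vtilde_sq_def of_nat_diff algebra_simps)
    finally show ?thesis .
  qed
  with R_span show ?thesis
    unfolding f_def by blast
qed

section \<open>One coordinate after removing the low-order atoms\<close>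

lemma vtilde_sq_nonneg: "0 \<le> vtilde_sq N (Suc k) p a b j"
  by (auto simp: vtilde_sq_def intro!: zero_le_power divide_nonneg_nonneg)

text \<open>Antiprojection is a contraction and the entries of the atom lie in
  \<open>[0, 1]\<close>. Division by \<open>N\<close> then puts squared norms in the unit interval,
  as the product estimate requires.\<close>

lemma dict_tilde_norm_le:
  assumes "Suc k \<le> j"
  shows "array_inner {1..N} (dict_tilde N (Suc k) j) (dict_tilde N (Suc k) j) \<le> real N"
proof -
  have "array_inner {1..N} (dict_tilde N (Suc k) j) (dict_tilde N (Suc k) j)
      \<le> array_inner {1..N} (dict N (Suc k) j) (dict N (Suc k) j)"
    unfolding dict_tilde_def
    using antiproj_norm_le[of "{1..N}" "(\<lambda>l. dict N l l) ` {1..Suc k}" 0 "dict N (Suc k) j"]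
    by (simp add: span_zero)
  also have "\<dots> \<le> real N * 1\<^sup>2"
  proof (rule array_inner_self_le_card[where D = "{1..N}"])
    fix x assume x: "x \<in> {1..N}"
    have "dict N (Suc k) j x \<le> (real (x - j + 1) / real N) ^ k"
      using dict_Suc_bounds(2)[OF assms] .
    also have "\<dots> \<le> 1"
      using x assms by (intro power_le_one) (auto simp: field_simps)
    finally show "\<bar>dict N (Suc k) j x\<bar> \<le> 1"
      using dict_Suc_bounds(1)[OF assms, of N x] by simp
  qed auto
  finally show ?thesis by simp
qed

text \<open>Antiprojecting the approximation from \<open>dict_approx\<close> does not increase its
  distance, and the orthogonal projection \<open>h\<close> is at least as close. The squared
  distance is stated as a difference of squared norms because each of these is multiplicative under
  tensor products.\<close>

lemma dict_tilde_proj: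
  assumes p: "Suc k < p" "p + k \<le> N" and j: "Suc k < j" "j \<le> N" "j \<in> {a..b}"
  shows "\<exists>h\<in>span (dict_tilde N (Suc k) ` {p..p + k}).
    array_inner {1..N} (dict_tilde N (Suc k) j) h = array_inner {1..N} h h \<and>
    array_inner {1..N} (dict_tilde N (Suc k) j) (dict_tilde N (Suc k) j) - array_inner {1..N} h h
      \<le> real N * vtilde_sq N (Suc k) p a b j"
proof -
  let ?I = "array_inner {1..N}"
  define W where "W = (\<lambda>l. dict N l l) ` {1..Suc k}"
  define U where "U = dict_tilde N (Suc k) ` {p..p + k}"
  define u where "u = dict_tilde N (Suc k) j"
  have fin: "finite W" "finite U" by (simp_all add: W_def U_def)
  have lin: "linear (antiproj {1..N} W)"
    by (rule linear_antiproj) (simp_all add: fin)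
  obtain g where g: "g \<in> span (dict N (Suc k) ` {p..p + k})"
    "?I (dict N (Suc k) j - g) (dict N (Suc k) j - g) \<le> real N * vtilde_sq N (Suc k) p a b j"
    using dict_approx[OF assms] by blast
  define g' where "g' = antiproj {1..N} W g"
  have "antiproj {1..N} W ` dict N (Suc k) ` {p..p + k} = U"
    by (simp add: U_def W_def image_image dict_tilde_def)
  then have g': "g' \<in> span U"
    using linear_span_image[OF lin] g(1) unfolding g'_def by (metis imageI)
  have "u - g' = antiproj {1..N} W (dict N (Suc k) j - g)"
    unfolding u_def g'_def dict_tilde_def W_def[symmetric] by (rule linear_diff[OF lin, symmetric])
  then have ug: "?I (u - g') (u - g') \<le> real N * vtilde_sq N (Suc k) p a b j"
    using antiproj_norm_le[of "{1..N}" W 0 "dict N (Suc k) j - g"] fin g(2)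
    by (simp add: span_zero)
  \<comment> \<open>The approximation \<open>g'\<close> need not satisfy
    \<open>?I u g' = ?I g' g'\<close>; the true projection does, and the tensor argument relies on
    it.\<close>
  obtain h where h: "h \<in> span U" "\<And>w. w \<in> U \<Longrightarrow> ?I (u - h) w = 0"
    using span_residual_ex[of "{1..N}" U u] fin by blast
  have orth: "?I (u - h) w = 0" if "w \<in> span U" for w
    by (rule array_inner_span_eq_0[OF h(2) that])
  have uh: "?I u h = ?I h h"
    using orth[OF h(1)] by (simp add: array_inner_simps)
  have "?I u g' = ?I h g'"
    using orth[OF g'] by (simp add: array_inner_simps)
  \<comment> \<open>Pythagoras: \<open>u - h\<close> is orthogonal to \<open>h - g'\<close>.\<close>
  then have "?I (u - g') (u - g') = ?I u u - ?I h h + ?I (h - g') (h - g')"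
    using array_inner_commute[of "{1..N}" u g'] array_inner_commute[of "{1..N}" h g']
    by (simp add: array_inner_simps)
  with ug array_inner_self_nonneg[of "{1..N}" "h - g'"]
  have "?I u u - ?I h h \<le> real N * vtilde_sq N (Suc k) p a b j" by simp
  with h(1) uh show ?thesis unfolding U_def u_def by blast
qed


section \<open>Tensor products\<close>

text \<open>Arbitrary factors are allowed, since the projections \<open>h i\<close> are combinations
  of atoms rather than atoms.\<close>

definition tensor :: "'i set \<Rightarrow> ('i \<Rightarrow> 'a set) \<Rightarrow> ('i \<Rightarrow> 'a \<Rightarrow> real) \<Rightarrow> ('i \<Rightarrow> 'a) \<Rightarrow> real"
  where "tensor I B f = (\<lambda>x. if x \<in> Pi\<^sub>E I B then \<Prod>i\<in>I. f i (x i) else 0)"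

lemma tensor_cong: "(\<And>i. i \<in> I \<Longrightarrow> f i = g i) \<Longrightarrow> tensor I B f = tensor I B g"
  by (auto simp: tensor_def fun_eq_iff intro!: prod.cong)

lemma array_inner_tensor:
  assumes "finite I" "\<And>i. i \<in> I \<Longrightarrow> finite (B i)"
  shows "array_inner (Pi\<^sub>E I B) (tensor I B f) (tensor I B g) = (\<Prod>i\<in>I. array_inner (B i) (f i) (g i))"
  using assms by (simp add: array_inner_def tensor_def prod_sum_PiE prod.distrib)

lemma linear_tensor_update:
  assumes "finite I" "a \<in> I"
  shows "linear (\<lambda>y. tensor I B (h(a := y)))"
proof -
  have eq: "tensor I B (h(a := y)) =
      (\<lambda>x. if x \<in> Pi\<^sub>E I B then y (x a) * (\<Prod>i\<in>I - {a}. h i (x i)) else 0)" for y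
    using assms by (auto simp: tensor_def fun_eq_iff prod.remove[of I a] intro!: prod.cong)
  show ?thesis
    unfolding eq by (rule linearI) (auto simp: fun_eq_iff scaleR_fun_def algebra_simps)
qed

text \<open>\<open>J\<close> holds the coordinates whose factor may be a combination; elsewhere it
  is a single atom. The induction frees one coordinate at a time by linearity in that slot, and
  \<open>J = I\<close> is the case wanted.\<close>

lemma tensor_in_span:
  assumes "finite I" "J \<subseteq> I"
    and "\<And>i. i \<in> J \<Longrightarrow> h i \<in> span (u i ` C i)" "\<And>i. i \<in> I - J \<Longrightarrow> h i \<in> u i ` C i"
  shows "tensor I B h \<in> span ((\<lambda>l. tensor I B (\<lambda>i. u i (l i))) ` Pi\<^sub>E I C)"
proof -
  have "finite J" using assms(1,2) by (rule finite_subset[rotated])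
  then show ?thesis
    using assms(2-4)
  proof (induction J arbitrary: h)
    case empty
    then have "\<forall>i\<in>I. \<exists>c. c \<in> C i \<and> h i = u i c" by auto
    then obtain l where l: "\<And>i. i \<in> I \<Longrightarrow> l i \<in> C i \<and> h i = u i (l i)" by metis
    \<comment> \<open>Restriction makes the chosen index extensional, hence a member of
      \<open>Pi\<^sub>E I C\<close>.\<close>
    have "tensor I B h = tensor I B (\<lambda>i. u i (restrict l I i))"
      using l by (intro tensor_cong) simp
    also have "\<dots> \<in> (\<lambda>l. tensor I B (\<lambda>i. u i (l i))) ` Pi\<^sub>E I C"
      by (rule image_eqI[OF refl]) (use l in auto)
    finally show ?case by (rule span_base)
  next
    case (insert a J)
    let ?V = "span ((\<lambda>l. tensor I B (\<lambda>i. u i (l i))) ` Pi\<^sub>E I C)"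
    let ?T = "\<lambda>y. tensor I B (h(a := y))"
    have "?T y \<in> ?V" if "y \<in> u a ` C a" for y
      using insert that by (intro insert.IH) auto
    then have "span (?T ` (u a ` C a)) \<subseteq> ?V"
      by (intro span_minimal subspace_span) blast
    moreover have "linear ?T"
      using insert.prems(1) assms(1) by (intro linear_tensor_update) auto
    ultimately have "?T ` span (u a ` C a) \<subseteq> ?V"
      by (simp only: linear_span_image)
    moreover have "h a \<in> span (u a ` C a)" using insert.prems by simp
    ultimately have "?T (h a) \<in> ?V" by blast
    then show ?case by simp
  qed
qed

section \<open>Assembling the bound in \<open>d\<close> dimensions\<close>

lemma tensor_dict_eq:
  "tensor_dict d n k j = tensor {1..d} (\<lambda>i. {1..n i}) (\<lambda>i. dict_tilde (n i) k (j i))"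
  by (auto simp: tensor_dict_def tensor_def grid_def hyperrect_def)

theorem lemma5p10:
  fixes d k s :: nat
    and n :: "nat \<Rightarrow> nat"
    and t tminus tplus :: "nat \<Rightarrow> nat \<Rightarrow> nat"
  assumes "d \<ge> 1"
    and "k \<in> {1..Min (n ` {1..d}) - 1}"
    and "t ` {1..s} \<subseteq> hyperrect d (\<lambda>_. k + 2) (\<lambda>i. n i - k)"
    and "hyperrect_tessellation d n k s t tminus tplus"
  shows "\<forall>m\<in>{1..s}. \<forall>j\<in>hyperrect d (tminus m) (tplus m).
    (L2_set (antiproj (grid d n) (tensor_dict d n k ` enlarged_active_set d k s t)
               (tensor_dict d n k j)) (grid d n))\<^sup>2
      / real (\<Prod>i = 1..d. n i)
    \<le> (vtilde d n k (t m) (tminus m) (tplus m) j)\<^sup>2"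
proof (intro ballI)
  fix m j
  assume m: "m \<in> {1..s}" and j: "j \<in> hyperrect d (tminus m) (tplus m)"
  \<comment> \<open>\<open>q\<close> is the polynomial degree, so a side of the block is
    \<open>[t m i : t m i + q]\<close>.\<close>
  obtain q where k: "k = Suc q" using assms(2) by (cases k) auto
  let ?I = "{1..d}"
  let ?X = "grid d n"
  define W where "W = tensor_dict d n k ` enlarged_active_set d k s t"
  define u where "u = (\<lambda>i. dict_tilde (n i) k (j i))"
  define v where "v = (\<lambda>i. vtilde_sq (n i) k (t m i) (tminus m i) (tplus m i) (j i))"
  have X: "?X = Pi\<^sub>E ?I (\<lambda>i. {1..n i})"
    by (simp add: grid_def hyperrect_def)
  have finX: "finite ?X" by (auto simp: X intro: finite_PiE)
  have finW: "finite W"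
    by (auto simp: W_def enlarged_active_set_def active_block_def hyperrect_def intro: finite_PiE)
  have jm: "j \<in> hyperrect d (\<lambda>_. k + 1) n"
    using assms(4) m j by (auto simp: hyperrect_tessellation_def)
  have tm: "t m \<in> hyperrect d (\<lambda>_. k + 2) (\<lambda>i. n i - k)"
    using assms(3) m by blast
  have ranges: "Suc q < t m i" "t m i + q \<le> n i" "Suc q < j i" "j i \<le> n i"
    "j i \<in> {tminus m i..tplus m i}" "n i > 0" if "i \<in> ?I" for i
  proof -
    have "t m i \<in> {k + 2..n i - k}" using tm that unfolding hyperrect_def by (rule PiE_mem)
    then show "Suc q < t m i" "t m i + q \<le> n i" "n i > 0" using k by auto
    have "j i \<in> {k + 1..n i}" using jm that unfolding hyperrect_def by (rule PiE_mem)
    then show "Suc q < j i" "j i \<le> n i" using k by auto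
    show "j i \<in> {tminus m i..tplus m i}" using j that unfolding hyperrect_def by (rule PiE_mem)
  qed
  have "\<forall>i\<in>?I. \<exists>h. h \<in> span (dict_tilde (n i) k ` {t m i..t m i + q}) \<and>
      array_inner {1..n i} (u i) h = array_inner {1..n i} h h \<and>
      array_inner {1..n i} (u i) (u i) - array_inner {1..n i} h h \<le> real (n i) * v i"
    unfolding k u_def v_def by (intro ballI) (use dict_tilde_proj ranges in blast)
  then obtain h where h:
    "\<And>i. i \<in> ?I \<Longrightarrow> h i \<in> span (dict_tilde (n i) k ` {t m i..t m i + q})"
    "\<And>i. i \<in> ?I \<Longrightarrow> array_inner {1..n i} (u i) (h i) = array_inner {1..n i} (h i) (h i)"
    "\<And>i. i \<in> ?I \<Longrightarrow>
      array_inner {1..n i} (u i) (u i) - array_inner {1..n i} (h i) (h i) \<le> real (n i) * v i"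
    by metis
  define a where "a = (\<lambda>i. array_inner {1..n i} (u i) (u i))"
  define b where "b = (\<lambda>i. array_inner {1..n i} (h i) (h i))"
  let ?U = "tensor ?I (\<lambda>i. {1..n i}) u"
  let ?H = "tensor ?I (\<lambda>i. {1..n i}) h"
  have "?H \<in> span ((\<lambda>l. tensor ?I (\<lambda>i. {1..n i}) (\<lambda>i. dict_tilde (n i) k (l i)))
      ` Pi\<^sub>E ?I (\<lambda>i. {t m i..t m i + q}))"
    by (rule tensor_in_span[where J = ?I]) (use h(1) in auto)
  moreover have "Pi\<^sub>E ?I (\<lambda>i. {t m i..t m i + q}) \<subseteq> enlarged_active_set d k s t"
    using m by (auto simp: enlarged_active_set_def active_block_def hyperrect_def k)
  ultimately have H: "?H \<in> span W"
    unfolding W_def tensor_dict_eq[abs_def] by (meson image_mono span_mono subsetD)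
  have b_le_a: "b i \<le> a i" if "i \<in> ?I" for i
    using array_inner_self_nonneg[of "{1..n i}" "u i - h i"] h(2)[OF that]
    by (simp add: a_def b_def array_inner_simps array_inner_commute[of _ "h i" "u i"])
  have a_le: "a i \<le> real (n i)" if "i \<in> ?I" for i
    unfolding a_def u_def k using ranges[OF that] by (intro dict_tilde_norm_le) simp
  have b_nonneg: "0 \<le> b i" for i
    unfolding b_def by (rule array_inner_self_nonneg)
  have inner: "array_inner ?X (tensor ?I (\<lambda>i. {1..n i}) f) (tensor ?I (\<lambda>i. {1..n i}) g)
      = (\<Prod>i\<in>?I. array_inner {1..n i} (f i) (g i))" for f g
    unfolding X by (rule array_inner_tensor) auto
  \<comment> \<open>Coordinatewise \<open>u i\<close> and \<open>h i\<close> have inner product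
    \<open>b i\<close>, so the cross terms in the squared norm of \<open>?U - ?H\<close> leave just
    \<open>prod a ?I - prod b ?I\<close>.\<close>
  have UH: "array_inner ?X ?U ?H = prod b ?I"
    unfolding inner b_def by (rule prod.cong[OF refl]) (rule h(2))
  have "array_inner ?X (?U - ?H) (?U - ?H) = prod a ?I - prod b ?I"
  proof -
    have "array_inner ?X ?U ?U = prod a ?I" "array_inner ?X ?H ?H = prod b ?I"
      by (simp_all only: inner a_def b_def)
    then show ?thesis
      using UH array_inner_commute[of ?X ?H ?U] by (simp add: array_inner_simps)
  qed
  then have "array_inner ?X (antiproj ?X W ?U) (antiproj ?X W ?U) \<le> prod a ?I - prod b ?I"
    using antiproj_norm_le[OF finX finW H, of ?U] by simp
  then have "(L2_set (antiproj ?X W (tensor_dict d n k j)) ?X)\<^sup>2 / real (\<Prod>i\<in>?I. n i)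
      \<le> (prod a ?I - prod b ?I) / real (\<Prod>i\<in>?I. n i)"
    unfolding L2_set_power2_eq_array_inner tensor_dict_eq u_def
    by (rule divide_right_mono) (rule of_nat_0_le_iff)
  also have "\<dots> = (\<Prod>i\<in>?I. a i / real (n i)) - (\<Prod>i\<in>?I. b i / real (n i))"
    by (simp add: diff_divide_distrib prod_dividef)
  also have "\<dots> \<le> (\<Sum>i\<in>?I. \<bar>a i / real (n i) - b i / real (n i)\<bar>)"
  proof -
    \<comment> \<open>Replacing one factor at a time changes the product by at most the difference
      of the two factors, because all the others have absolute value at most 1.\<close>
    have "norm ((\<Prod>i\<in>?I. a i / real (n i)) - (\<Prod>i\<in>?I. b i / real (n i)))
        \<le> (\<Sum>i\<in>?I. norm (a i / real (n i) - b i / real (n i)))"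
    proof (rule norm_prod_diff)
      fix i assume i: "i \<in> ?I"
      note bounds = b_nonneg[of i] b_le_a[OF i] a_le[OF i] ranges(6)[OF i]
      show "norm (a i / real (n i)) \<le> 1" "norm (b i / real (n i)) \<le> 1"
        using bounds by auto
    qed
    then show ?thesis by simp
  qed
  also have "\<dots> \<le> (\<Sum>i\<in>?I. v i)"
  proof (rule sum_mono)
    fix i assume i: "i \<in> ?I"
    have "\<bar>a i / real (n i) - b i / real (n i)\<bar> = (a i - b i) / real (n i)"
      using b_le_a[OF i] by (simp add: diff_divide_distrib[symmetric])
    also have "\<dots> \<le> v i"
      using h(3)[OF i] ranges(6)[OF i] by (simp add: a_def b_def field_simps)
    finally show "\<bar>a i / real (n i) - b i / real (n i)\<bar> \<le> v i" .
  qed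
  also have "\<dots> = (vtilde d n k (t m) (tminus m) (tplus m) j)\<^sup>2"
    by (simp add: vtilde_def v_def sum_nonneg vtilde_sq_nonneg k)
  finally show "(L2_set (antiproj ?X (tensor_dict d n k ` enlarged_active_set d k s t)
               (tensor_dict d n k j)) ?X)\<^sup>2 / real (\<Prod>i\<in>?I. n i)
    \<le> (vtilde d n k (t m) (tminus m) (tplus m) j)\<^sup>2"
    unfolding W_def .
qed

end
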